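(* Let $m\ge2$, $q\ge1$ and $k\ge m$ be integers, let $\beta=\beta_{q,m}$, and let $a_1\ldots a_{k+1},\,b_1\ldots b_{k+1}\in\{0,1,\ldots,\lfloor\beta\rfloor+1\}^{k+1}$ be such that the matching interval $I=I_{\beta}(a_1\ldots a_{k+1},b_1\ldots b_{k+1})$ is nonempty and contained in $[1-\langle\beta\rangle,1)$. If $\delta^k(\beta,\alpha)>0$ for $\alpha\in I$, then $M_{\beta}$ is increasing on $I$. Otherwise, $M_{\beta}$ is decreasing on $I$.
   Context: For a real number $r$, $\lfloor r\rfloor$ is its integer part and $\langle r\rangle=r-\lfloor r\rfloor$; $\lambda$ is Lebesgue measure. For integers $q\ge 1$, $m\ge 2$, $\beta_{q,m}$ is the unique real root in $(q,q+1)$ of $x^m=q x^{m-1}+q x^{m-2}+\cdots+q$. For $\beta>1$ and $\alpha\in[0,1)$, let $T_{\beta,\alpha}:[0,1]\to[0,1]$, $T_{\beta,\alpha}(x)=\beta x+\alpha-\lfloor\beta x+\alpha\rfloor$, with iterates $T_{\beta,\alpha}^n$ ($T_{\beta,\alpha}^0$ the identity). $T_{\beta,\alpha}$ has matching at time $k$ if $k$ is the smallest positive integer with $T_{\beta,\alpha}^k(0)=T_{\beta,\alpha}^k(1)$. For an integer $i\ge0$ let $\Delta(i)=\{x\in[0,1]:\lfloor\beta x+\alpha\rfloor=i\}$ (depending on $\beta,\alpha$). The matching interval associated with $(a_1\ldots a_{k+1},b_1\ldots b_{k+1})$ is $$I_\beta(a_1\ldots a_{k+1},b_1\ldots b_{k+1})=\{\alpha\in[0,1):\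 T_{\beta,\alpha}\text{ has matching at time }k+1,\ T_{\beta,\alpha}^{i-1}(0)\in\Delta(a_i)\text{ and }T_{\beta,\alpha}^{i-1}(1)\in\Delta(b_i)\ \text{for all }1\le i\le k+1\}.$$ Let $\delta^k(\beta,\alpha)=T_{\beta,\alpha}^k(1)-T_{\beta,\alpha}^k(0)$; for $\alpha\in I_\beta(a_1\ldots a_{k+1},b_1\ldots b_{k+1})$ it equals $\beta^k\bigl(1+\sum_{j=1}^k (a_j-b_j)\beta^{-j}\bigr)$, hence does not depend on $\alpha$ there. Define, for $x\in[0,1]$, $$\tilde g_{\beta,\alpha}(x)=\sum_{n\ge 0:\ x<T_{\beta,\alpha}^n(1)}\frac{1}{\beta^n}-\sum_{n\ge 0:\ x<T_{\beta,\alpha}^n(0)}\frac{1}{\beta^n},\qquad g_{\beta,\alpha}(x)=\frac{\tilde g_{\beta,\alpha}(x)}{\int_{[0,1]}\tilde g_{\beta,\alpha}\,d\lambda},$$ and $M_\beta(\alpha)=\int_{[0,1]}x\,g_{\beta,\alpha}(x)\,d\lambda(x)$. *)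

theory Defs
  imports "HOL-Analysis.Analysis"
begin

definition beta_qm :: "nat \<Rightarrow> nat \<Rightarrow> real" where
  "beta_qm q m = (THE x. real q < x \<and> x < real q + 1 \<and> x ^ m = (\<Sum>i<m. real q * x ^ i))"

text \<open>The maps are considered on \<open>[0,1]\<close>, including the endpoint \<open>1\<close>, which is not
  identified with \<open>0\<close>; \<open>frac r\<close> is \<open>r - \<lfloor>r\<rfloor>\<close>.\<close>

definition T :: "real \<Rightarrow> real \<Rightarrow> real \<Rightarrow> real" where
  "T \<beta> \<alpha> x = frac (\<beta> * x + \<alpha>)"

definition has_matching_at :: "real \<Rightarrow> real \<Rightarrow> nat \<Rightarrow> bool" where
  "has_matching_at \<beta> \<alpha> k \<longleftrightarrow>
     0 < k \<and> (T \<beta> \<alpha> ^^ k) 0 = (T \<beta> \<alpha> ^^ k) 1 \<and>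
     (\<forall>j. 0 < j \<and> j < k \<longrightarrow> (T \<beta> \<alpha> ^^ j) 0 \<noteq> (T \<beta> \<alpha> ^^ j) 1)"

definition \<Delta> :: "real \<Rightarrow> real \<Rightarrow> int \<Rightarrow> real set" where
  "\<Delta> \<beta> \<alpha> i = {x \<in> {0..1}. \<lfloor>\<beta> * x + \<alpha>\<rfloor> = i}"

text \<open>The words \<open>a\<^sub>1 \<dots> a\<^sub>k\<^sub>+\<^sub>1\<close> and \<open>b\<^sub>1 \<dots> b\<^sub>k\<^sub>+\<^sub>1\<close> are lists
  of the same length \<open>k + 1\<close>; as lists are indexed from \<open>0\<close>, the letter \<open>a\<^sub>i\<close> is
  \<open>as ! (i - 1)\<close>.\<close>

definition matching_interval :: "real \<Rightarrow> int list \<Rightarrow> int list \<Rightarrow> real set" where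
  "matching_interval \<beta> as bs =
     {\<alpha> \<in> {0..<1}. has_matching_at \<beta> \<alpha> (length as) \<and>
        (\<forall>i<length as. (T \<beta> \<alpha> ^^ i) 0 \<in> \<Delta> \<beta> \<alpha> (as ! i) \<and> (T \<beta> \<alpha> ^^ i) 1 \<in> \<Delta> \<beta> \<alpha> (bs ! i))}"

definition \<delta> :: "nat \<Rightarrow> real \<Rightarrow> real \<Rightarrow> real" where
  "\<delta> k \<beta> \<alpha> = (T \<beta> \<alpha> ^^ k) 1 - (T \<beta> \<alpha> ^^ k) 0"

definition g_tilde :: "real \<Rightarrow> real \<Rightarrow> real \<Rightarrow> real" where
  "g_tilde \<beta> \<alpha> x =
     (\<Sum>\<^sub>\<infinity>n\<in>{n. x < (T \<beta> \<alpha> ^^ n) 1}. 1 / \<beta> ^ n) - (\<Sum>\<^sub>\<infinity>n\<in>{n. x < (T \<beta> \<alpha> ^^ n) 0}. 1 / \<beta> ^ n)"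

definition g :: "real \<Rightarrow> real \<Rightarrow> real \<Rightarrow> real" where
  "g \<beta> \<alpha> x = g_tilde \<beta> \<alpha> x / (LINT y:{0..1}|lborel. g_tilde \<beta> \<alpha> y)"

definition M :: "real \<Rightarrow> real \<Rightarrow> real" where
  "M \<beta> \<alpha> = (LINT x:{0..1}|lborel. x * g \<beta> \<alpha> x)"

end

theory Submission
  imports Defs
begin

text \<open>
  Write \<open>d\<^sub>n = T\<^sup>n(1) - T\<^sup>n(0)\<close> and let \<open>k + 1\<close> be the matching time. After it the two orbits
  coincide, so the series defining \<open>g_tilde\<close> collapses to a finite sum of indicators of intervals
  \<open>[0, T\<^sup>n(1))\<close> and \<open>[0, T\<^sup>n(0))\<close>, and integration gives \<open>M\<close> in closed form (\<open>M_matching\<close>). On a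
  matching interval the digits of both orbits are fixed, so \<open>T\<^sup>n(0)\<close> and \<open>T\<^sup>n(1)\<close> are affine in
  \<open>\<alpha>\<close> with the same slope \<open>(\<beta>\<^sup>n - 1) / (\<beta> - 1)\<close> and \<open>d\<^sub>n\<close> is constant. Hence \<open>M\<close> is affine
  there, with slope
  \<open>(S - C) / ((\<beta> - 1) C)\<close> where \<open>S = \<Sum>n\<le>k. d\<^sub>n\<close> and \<open>C = \<Sum>n\<le>k. d\<^sub>n / \<beta>\<^sup>n\<close> (\<open>M_difference\<close>).
  What remains is to find the signs of \<open>C\<close> and \<open>S - C\<close>.

  For a multinacci number the differences have a rigid form. Since \<open>\<beta> = q + 1 - q / \<beta>\<^sup>m\<close>, a positive
  difference leaves behind, once the integer part is removed, a debt \<open>q / \<beta>\<^sup>m\<close>, which grows by a factor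
  \<open>\<beta>\<close> at each step until it has become the integer \<open>q\<close> and vanishes. So \<open>d\<^sub>n = \<epsilon>\<^sub>n - L\<^sub>n\<close>, where
  \<open>\<epsilon>\<^sub>n \<in> {0, 1}\<close> indicates \<open>d\<^sub>n > 0\<close> and \<open>L\<^sub>n \<in> [0, 1]\<close> collects the debts of the last \<open>m\<close> steps
  (\<open>d_eq_digit_minus_debt\<close>). Summation by columns turns \<open>S\<close> and \<open>C\<close> into combinations of the
  \<open>\<epsilon>\<^sub>t\<close>, whose coefficients are \<open>1\<close> minus what the step \<open>t\<close> costs up to time \<open>k\<close>. Over \<open>m\<close> steps the
  undiscounted cost is \<open>\<Sum>j=1..m. q / \<beta>\<^sup>j = 1\<close>, so only the last \<open>m\<close> indices contribute to \<open>S\<close>; the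
  discounted cost is always below \<open>1\<close>, so \<open>C > 0\<close>.

  At matching \<open>L\<close> is an integer, hence \<open>0\<close> or \<open>1\<close>, so the last \<open>m\<close> digits are all \<open>0\<close> or all \<open>1\<close>. In
  the first case \<open>d\<^sub>k < 0\<close>, \<open>S = 0\<close>, and the slope is \<open>- 1 / (\<beta> - 1)\<close>. In the second case \<open>d\<^sub>k > 0\<close> and
  \<open>S \<ge> 1 + q / \<beta>\<close>. The restriction of \<open>\<alpha>\<close> to \<open>[1 - frac \<beta>, 1)\<close> forces \<open>\<epsilon>\<^sub>1 = 0\<close>, which keeps
  \<open>C\<close> below that bound (\<open>discounted_sum_less_sum\<close>).
\<close>

section \<open>The multinacci numbers\<close>

lemma beta_qm_root:
  assumes "m \<ge> 2" and "q \<ge> 1"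
  shows "real q < beta_qm q m" and "beta_qm q m < real q + 1"
    and "beta_qm q m ^ m = (\<Sum>i<m. real q * beta_qm q m ^ i)"
proof -
  let ?P = "\<lambda>x::real. real q < x \<and> x < real q + 1 \<and> x ^ m = (\<Sum>i<m. real q * x ^ i)"
  let ?f = "\<lambda>x::real. x ^ m - (\<Sum>i<m. real q * x ^ i)"
  have q1: "real q \<ge> 1" using assms by simp
  have at_q: "?f (real q) < 0"
  proof -
    have "(\<Sum>i\<in>{0, m - 1}. real q * real q ^ i) \<le> (\<Sum>i<m. real q * real q ^ i)"
      using assms by (intro sum_mono2) auto
    moreover have "(\<Sum>i\<in>{0, m - 1}. real q * real q ^ i) = real q + real q ^ m"
      using assms by (cases m) auto
    ultimately show ?thesis using q1 by linarith
  qed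
  have at_q1: "?f (real q + 1) = 1"
    using one_diff_power_eq[of "real q + 1" m] q1 by (simp add: sum_distrib_left[symmetric])
  have "\<exists>x\<ge>real q. x \<le> real q + 1 \<and> ?f x = 0"
    using at_q at_q1 by (intro IVT' continuous_intros) auto
  then obtain x where x: "real q \<le> x" "x \<le> real q + 1" "?f x = 0" by blast
  have "x \<noteq> real q" "x \<noteq> real q + 1" using at_q at_q1 x(3) by auto
  then have Px: "?P x" using x by auto
  have no_two: False if "?P y" "?P z" "y < z" for y z
  proof -
    \<comment> \<open>after division by \<open>x ^ m\<close> the equation reads \<open>1 = (\<Sum>i<m. q / x ^ (m - i))\<close>,
      with a strictly decreasing right-hand side\<close>
    have quot: "(\<Sum>i<m. real q / x ^ (m - i)) = 1" if "?P x" for x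
    proof -
      have x0: "x > 0" using that q1 by linarith
      have "(\<Sum>i<m. real q / x ^ (m - i)) = (\<Sum>i<m. real q * x ^ i / x ^ m)"
        using x0 by (intro sum.cong) (auto simp: power_diff)
      also have "\<dots> = x ^ m / x ^ m"
        using that by (simp add: sum_divide_distrib[symmetric])
      finally show ?thesis using x0 by simp
    qed
    have "(\<Sum>i<m. real q / z ^ (m - i)) < (\<Sum>i<m. real q / y ^ (m - i))"
    proof (rule sum_strict_mono)
      fix i assume "i \<in> {..<m}"
      then show "real q / z ^ (m - i) < real q / y ^ (m - i)"
        using that q1 by (intro divide_strict_left_mono power_strict_mono mult_pos_pos) auto
    qed (use assms in \<open>auto simp: lessThan_empty_iff\<close>)
    then show False using quot[OF that(1)] quot[OF that(2)] by simp
  qed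
  have "?P (THE x. ?P x)"
  proof (rule theI[of ?P, OF Px])
    fix y assume "?P y"
    then show "y = x" using no_two[of x y] no_two[of y x] Px by (meson linorder_neqE_linordered_idom)
  qed
  then show "real q < beta_qm q m" and "beta_qm q m < real q + 1"
    and "beta_qm q m ^ m = (\<Sum>i<m. real q * beta_qm q m ^ i)"
    unfolding beta_qm_def by blast+
qed

locale multinacci =
  fixes q m :: nat and \<beta> :: real
  assumes m2: "m \<ge> 2" and q1: "q \<ge> 1"
    and gt_q: "real q < \<beta>" and lt_q1: "\<beta> < real q + 1"
    and root: "\<beta> ^ m = (\<Sum>i<m. real q * \<beta> ^ i)"
begin

lemma gt_1: "\<beta> > 1"
  using q1 gt_q by linarith

text \<open>Multiplying the equation of \<open>\<beta>\<close> by \<open>\<beta> - 1\<close> shows how far \<open>\<beta>\<close> is from the next integer.\<close>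

lemma beta_eq: "\<beta> = real q + 1 - real q / \<beta> ^ m"
proof -
  have "(1 - \<beta>) * (\<Sum>i<m. \<beta> ^ i) = 1 - \<beta> ^ m"
    by (rule one_diff_power_eq[symmetric])
  then have "(1 - \<beta>) * \<beta> ^ m = real q * (1 - \<beta> ^ m)"
    unfolding root sum_distrib_left[symmetric]
    by (metis mult.left_commute)
  then show ?thesis using gt_1 by (simp add: field_simps)
qed

text \<open>The debt that a positive difference still causes \<open>i + 1\<close> steps later.\<close>

definition w :: "nat \<Rightarrow> real" where
  "w i = (if i < m then real q / \<beta> ^ (m - i) else 0)"

lemma w_nonneg: "w i \<ge> 0"
  using gt_1 by (simp add: w_def)

lemma w_pos: "i < m \<Longrightarrow> w i > 0"
  using gt_1 q1 by (simp add: w_def)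

lemma w_Suc: "w (Suc r) = \<beta> * w r - (if Suc r = m then real q else 0)"
proof -
  have "Suc r < m \<Longrightarrow> \<beta> ^ (m - r) = \<beta> * \<beta> ^ (m - Suc r)"
    by (metis Suc_diff_Suc Suc_lessD power_Suc)
  moreover have "Suc r = m \<Longrightarrow> m - r = 1" by auto
  ultimately show ?thesis using gt_1 by (auto simp: w_def)
qed

lemma sum_w_prefix: "m \<le> r \<Longrightarrow> (\<Sum>i<r. w i) = 1"
proof -
  assume "m \<le> r"
  then have "(\<Sum>i<r. w i) = (\<Sum>i<m. w i)"
    by (intro sum.mono_neutral_right) (auto simp: w_def)
  also have "\<dots> = (\<Sum>i<m. real q * \<beta> ^ i / \<beta> ^ m)"
    using gt_1 by (intro sum.cong) (auto simp: w_def power_diff)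
  also have "\<dots> = 1"
    using gt_1 by (simp add: sum_divide_distrib[symmetric] root[symmetric])
  finally show ?thesis .
qed

lemma sum_w_le_1: "(\<Sum>i<r. w i) \<le> 1"
proof -
  have "(\<Sum>i<r. w i) \<le> (\<Sum>i<max r m. w i)"
    by (intro sum_mono2) (auto simp: w_nonneg)
  then show ?thesis by (simp add: sum_w_prefix)
qed

text \<open>The one debt that is missing here is the last and largest, \<open>q / \<beta>\<close>.\<close>

lemma sum_w_but_last: "(\<Sum>i<m - 1. w i) = 1 - real q / \<beta>"
proof -
  have "(\<Sum>i<m. w i) = (\<Sum>i<m - 1. w i) + w (m - 1)"
    using m2 by (cases m) auto
  moreover have "w (m - 1) = real q / \<beta>"
    using m2 by (simp add: w_def)
  ultimately show ?thesis by (simp add: sum_w_prefix)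
qed

text \<open>Discounting cancels the growth of the debt: each of the \<open>m\<close> terms is \<open>q / \<beta> ^ (m + 1)\<close>.\<close>

lemma sum_w_discounted: "m \<le> r \<Longrightarrow> (\<Sum>i<r. w i * (1 / \<beta>) ^ Suc i) = m * q / \<beta> ^ Suc m"
proof -
  assume "m \<le> r"
  then have "(\<Sum>i<r. w i * (1 / \<beta>) ^ Suc i) = (\<Sum>i<m. w i * (1 / \<beta>) ^ Suc i)"
    by (intro sum.mono_neutral_right) (auto simp: w_def)
  also have "\<dots> = (\<Sum>i<m. q / \<beta> ^ Suc m)"
  proof (intro sum.cong refl)
    fix i assume "i \<in> {..<m}"
    then have "Suc m = (m - i) + Suc i" "i < m" by auto
    then have "\<beta> ^ Suc m = \<beta> ^ (m - i) * \<beta> ^ Suc i" by (metis power_add)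
    then show "w i * (1 / \<beta>) ^ Suc i = q / \<beta> ^ Suc m"
      using \<open>i < m\<close> by (simp only: w_def power_one_over if_True times_divide_times_eq mult_1_right)
  qed
  finally show ?thesis by simp
qed

lemma mq_less: "m * q < \<beta> ^ m"
proof -
  have "(\<Sum>i<m. real q) < (\<Sum>i<m. real q * \<beta> ^ i)"
  proof (rule sum_strict_mono_ex1)
    show "\<forall>i\<in>{..<m}. real q \<le> real q * \<beta> ^ i"
      using gt_1 q1 by (auto simp: one_le_power)
    show "\<exists>i\<in>{..<m}. real q < real q * \<beta> ^ i"
      using gt_1 q1 m2 by (intro bexI[of _ 1]) auto
  qed auto
  then show ?thesis by (simp add: root)
qed

lemma sum_w_discounted_less_1: "(\<Sum>i<r. w i * (1 / \<beta>) ^ Suc i) < 1"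
proof -
  have "(\<Sum>i<r. w i * (1 / \<beta>) ^ Suc i) \<le> (\<Sum>i<max r m. w i * (1 / \<beta>) ^ Suc i)"
    using gt_1 by (intro sum_mono2) (auto simp: w_nonneg)
  also have "\<dots> = m * q / \<beta> ^ Suc m" by (intro sum_w_discounted) simp
  also have "\<dots> < \<beta> ^ m / \<beta> ^ Suc m"
    using mq_less gt_1 by (intro divide_strict_right_mono) auto
  also have "\<dots> < 1" using gt_1 by simp
  finally show ?thesis .
qed

text \<open>This is the estimate on which the increasing case rests. For \<open>q \<ge> 2\<close> the left-hand side is below
  \<open>1\<close>. For \<open>q = 1\<close>, where \<open>\<beta> = 2 - u\<close> with \<open>u = 1 / \<beta> ^ m\<close>, it says \<open>1 < (1 - u) * (1 + m * u)\<close>,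
  which reduces to \<open>m * u < m - 1\<close>; the term \<open>m * q / \<beta> ^ m\<close> cannot be dropped when \<open>q = 1\<close> and
  \<open>m = 2\<close>.\<close>

lemma gap_inequality: "1 / (\<beta> - 1) < real q + m * q / \<beta> ^ m"
proof (cases "q = 1")
  case True
  define u where "u = 1 / \<beta> ^ m"
  have u: "\<beta> = 2 - u" using beta_eq True by (simp add: u_def)
  have u0: "u > 0" and mu: "m * u < 1"
    using gt_1 mq_less True by (auto simp: u_def)
  have "0 < u * (m - 1 - m * u)"
    using u0 mu m2 by (intro mult_pos_pos) auto
  also have "u * (m - 1 - m * u) = (1 - u) * (1 + m * u) - 1"
    using m2 by (simp add: of_nat_diff algebra_simps)
  finally have "1 < (1 - u) * (1 + m * u)" by simp
  moreover have "1 - u > 0" using gt_1 u by simp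
  ultimately have "1 / (1 - u) < 1 + m * u" by (simp add: field_simps)
  moreover have "\<beta> - 1 = 1 - u" using u by simp
  ultimately have "1 / (\<beta> - 1) < 1 + m * u" by (simp only:)
  then show ?thesis using True by (simp add: u_def)
next
  case False
  then have "real q \<ge> 2" using q1 by linarith
  then have "1 / (\<beta> - 1) < 1" using gt_q by simp
  moreover have "m * q / \<beta> ^ m \<ge> 0" using gt_1 by simp
  ultimately show ?thesis using \<open>real q \<ge> 2\<close> by linarith
qed

end

section \<open>Differences of two orbits until they meet\<close>

text \<open>Exchange of summation: \<open>e t\<close> enters at time \<open>t\<close> with weight \<open>z ^ t\<close> and is charged \<open>v i\<close> at each
  later time \<open>t + i + 1 \<le> N\<close>. It is used with \<open>z = 1\<close> and \<open>z = 1 / \<beta>\<close>.\<close>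

lemma sum_convolution:
  fixes e v :: "nat \<Rightarrow> real"
  shows "(\<Sum>n\<le>N. (e n - (\<Sum>t<n. e t * v (n - Suc t))) * z ^ n)
       = (\<Sum>t\<le>N. e t * z ^ t * (1 - (\<Sum>i<N - t. v i * z ^ Suc i)))"
proof (induction N)
  case 0
  show ?case by simp
next
  case (Suc N)
  have "(\<Sum>t\<le>N. e t * z ^ t * (1 - (\<Sum>i<Suc N - t. v i * z ^ Suc i)))
      = (\<Sum>t\<le>N. e t * z ^ t * (1 - (\<Sum>i<N - t. v i * z ^ Suc i)) - e t * v (N - t) * z ^ Suc N)"
  proof (intro sum.cong refl)
    fix t assume "t \<in> {..N}"
    then have t: "Suc N - t = Suc (N - t)" "Suc N = t + Suc (N - t)" by auto
    have "z ^ Suc N = z ^ t * z ^ Suc (N - t)" by (subst t(2), rule power_add)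
    then show "e t * z ^ t * (1 - (\<Sum>i<Suc N - t. v i * z ^ Suc i))
      = e t * z ^ t * (1 - (\<Sum>i<N - t. v i * z ^ Suc i)) - e t * v (N - t) * z ^ Suc N"
      unfolding t(1) sum.lessThan_Suc by (simp only:) (simp add: algebra_simps)
  qed
  also have "\<dots> = (\<Sum>t\<le>N. e t * z ^ t * (1 - (\<Sum>i<N - t. v i * z ^ Suc i)))
                 - (\<Sum>t\<le>N. e t * v (N - t)) * z ^ Suc N"
    by (simp add: sum_subtractf sum_distrib_right)
  finally show ?case
    using Suc.IH by (simp add: lessThan_Suc_atMost algebra_simps)
qed

text \<open>Of the dynamics, only these properties of the differences of the two orbits matter. The
  number \<open>k\<close> is the last time before the orbits meet.\<close>

locale matching_differences = multinacci +
  fixes d :: "nat \<Rightarrow> real" and k :: nat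
  assumes d_0: "d 0 = 1"
    and d_bound: "\<And>n. 0 < n \<Longrightarrow> n \<le> k \<Longrightarrow> \<bar>d n\<bar> < 1"
    and d_nonzero: "\<And>n. n \<le> k \<Longrightarrow> d n \<noteq> 0"
    and d_step: "\<And>n. n \<le> k \<Longrightarrow> d (Suc n) - \<beta> * d n \<in> \<int>"
    and d_end: "d (Suc k) = 0"
begin

definition \<epsilon> :: "nat \<Rightarrow> real" where "\<epsilon> n = of_bool (0 < d n)"

definition debt :: "nat \<Rightarrow> real" where "debt n = (\<Sum>t<n. \<epsilon> t * w (n - Suc t))"

lemma debt_nonneg: "debt n \<ge> 0"
  unfolding debt_def by (intro sum_nonneg mult_nonneg_nonneg) (auto simp: w_nonneg \<epsilon>_def)

lemma debt_le_1: "debt n \<le> 1"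
proof -
  have "debt n \<le> (\<Sum>t<n. w (n - Suc t))"
    unfolding debt_def by (intro sum_mono) (auto simp: \<epsilon>_def w_nonneg)
  also have "\<dots> = (\<Sum>i<n. w i)" by (rule sum.nat_diff_reindex)
  finally show ?thesis using sum_w_le_1 by (rule order_trans)
qed

text \<open>Outstanding debts grow by the factor \<open>\<beta>\<close>, a new one of size \<open>q / \<beta> ^ m\<close> is incurred if the present
  difference is positive, and the one from \<open>m\<close> steps ago has reached the integer \<open>q\<close> and is
  dropped.\<close>

lemma debt_Suc:
  "debt (Suc n) = \<beta> * debt n + \<epsilon> n * (real q / \<beta> ^ m) - of_bool (m \<le> n) * (\<epsilon> (n - m) * real q)"
proof -
  have "debt (Suc n) = (\<Sum>t<n. \<epsilon> t * w (n - t)) + \<epsilon> n * w 0"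
    by (simp add: debt_def)
  also have "(\<Sum>t<n. \<epsilon> t * w (n - t))
      = (\<Sum>t<n. \<beta> * (\<epsilon> t * w (n - Suc t)) - (if t = n - m \<and> m \<le> n then \<epsilon> t * real q else 0))"
  proof (intro sum.cong refl)
    fix t assume "t \<in> {..<n}"
    then have t: "n - t = Suc (n - Suc t)" "n - t = m \<longleftrightarrow> t = n - m \<and> m \<le> n" using m2 by auto
    have "w (n - t) = \<beta> * w (n - Suc t) - (if t = n - m \<and> m \<le> n then real q else 0)"
      using w_Suc[of "n - Suc t"] unfolding t(1)[symmetric] t(2) .
    then show "\<epsilon> t * w (n - t)
      = \<beta> * (\<epsilon> t * w (n - Suc t)) - (if t = n - m \<and> m \<le> n then \<epsilon> t * real q else 0)"
      by (simp only:) (simp add: algebra_simps)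
  qed
  also have "\<dots> = \<beta> * debt n - (\<Sum>t<n. if t = n - m then of_bool (m \<le> n) * (\<epsilon> t * real q) else 0)"
    unfolding sum_subtractf debt_def sum_distrib_left[symmetric]
    by (intro arg_cong2[of _ _ _ _ "(-)"] sum.cong refl) auto
  also have "(\<Sum>t<n. if t = n - m then of_bool (m \<le> n) * (\<epsilon> t * real q) else 0)
      = of_bool (m \<le> n) * (\<epsilon> (n - m) * real q)"
    using m2 by (auto simp: sum.delta)
  finally show ?thesis using m2 by (simp add: w_def)
qed

text \<open>A new debt is exactly what \<open>\<beta>\<close> lacks to be an integer: \<open>\<beta> + q / \<beta> ^ m = q + 1\<close>.\<close>

lemma step_integral:
  assumes "n \<le> k" and "d n = \<epsilon> n - debt n"
  shows "d (Suc n) + debt (Suc n) \<in> \<int>"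
proof -
  have "\<beta> * d n + debt (Suc n)
      = \<epsilon> n * (\<beta> + real q / \<beta> ^ m) - of_bool (m \<le> n) * (\<epsilon> (n - m) * real q)"
    unfolding assms(2) debt_Suc by (simp add: algebra_simps)
  also have "\<beta> + real q / \<beta> ^ m = real q + 1" using beta_eq by simp
  also have "\<epsilon> n * (real q + 1) - of_bool (m \<le> n) * (\<epsilon> (n - m) * real q) \<in> \<int>"
    by (intro Ints_diff Ints_mult Ints_add) (auto simp: \<epsilon>_def)
  finally have "(d (Suc n) - \<beta> * d n) + (\<beta> * d n + debt (Suc n)) \<in> \<int>"
    using d_step[OF assms(1)] by (rule Ints_add[rotated])
  then show ?thesis by simp
qed

text \<open>By the previous lemma \<open>d n + debt n\<close> is an integer. As \<open>0 < \<bar>d n\<bar> < 1\<close> and \<open>0 \<le> debt n \<le> 1\<close>, the sign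
  of \<open>d n\<close> decides whether this integer is \<open>0\<close> or \<open>1\<close>.\<close>

lemma d_eq_digit_minus_debt: "n \<le> k \<Longrightarrow> d n = \<epsilon> n - debt n"
proof (induction n)
  case 0
  show ?case by (simp add: d_0 \<epsilon>_def debt_def)
next
  case (Suc n)
  have "d (Suc n) + debt (Suc n) \<in> \<int>"
    using Suc by (intro step_integral) auto
  then obtain j :: int where j: "d (Suc n) + debt (Suc n) = of_int j"
    by (elim Ints_cases)
  have b: "\<bar>d (Suc n)\<bar> < 1" "d (Suc n) \<noteq> 0"
    using d_bound[of "Suc n"] d_nonzero[of "Suc n"] Suc.prems by auto
  show ?case
  proof (cases "d (Suc n) > 0")
    case True
    then have "0 < real_of_int j" "real_of_int j < 2"
      using b j debt_nonneg[of "Suc n"] debt_le_1[of "Suc n"] by linarith+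
    then have "j = 1" by linarith
    then show ?thesis using j True by (simp add: \<epsilon>_def)
  next
    case False
    then have "-1 < real_of_int j" "real_of_int j < 1"
      using b j debt_nonneg[of "Suc n"] debt_le_1[of "Suc n"] by linarith+
    then have "j = 0" by linarith
    then show ?thesis using j False by (simp add: \<epsilon>_def)
  qed
qed

lemma sum_d: "(\<Sum>n\<le>k. d n * z ^ n) = (\<Sum>t\<le>k. \<epsilon> t * z ^ t * (1 - (\<Sum>i<k - t. w i * z ^ Suc i)))"
  using sum_convolution[of \<epsilon> w z k] by (simp add: d_eq_digit_minus_debt debt_def)

lemma discounted_sum_pos: "0 < (\<Sum>n\<le>k. d n * (1 / \<beta>) ^ n)"
  unfolding sum_d
proof (rule sum_pos2[of _ 0])
  show "0 < \<epsilon> 0 * (1 / \<beta>) ^ 0 * (1 - (\<Sum>i<k - 0. w i * (1 / \<beta>) ^ Suc i))"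
    using sum_w_discounted_less_1[of k] by (simp add: \<epsilon>_def d_0)
  show "0 \<le> \<epsilon> t * (1 / \<beta>) ^ t * (1 - (\<Sum>i<k - t. w i * (1 / \<beta>) ^ Suc i))" for t
    using sum_w_discounted_less_1[of "k - t"] gt_1
    by (intro mult_nonneg_nonneg) (auto simp: \<epsilon>_def)
qed auto

lemma final_debt: "debt (Suc k) = 0 \<or> debt (Suc k) = 1"
proof -
  have "debt (Suc k) \<in> \<int>"
    using step_integral[of k] by (simp add: d_eq_digit_minus_debt d_end)
  then obtain j :: int where "debt (Suc k) = of_int j" by (elim Ints_cases)
  then show ?thesis using debt_nonneg[of "Suc k"] debt_le_1[of "Suc k"] by force
qed

text \<open>The total weight of the last \<open>m\<close> steps is \<open>1\<close>, so the two extreme values of the debt leave no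
  choice for the digits.\<close>

lemma final_digits_0:
  assumes "debt (Suc k) = 0" and "t \<le> k" and "k < t + m"
  shows "\<epsilon> t = 0"
proof -
  have "\<forall>t\<in>{..<Suc k}. \<epsilon> t * w (Suc k - Suc t) = 0"
    using assms(1) unfolding debt_def
    by (subst (asm) sum_nonneg_eq_0_iff) (auto simp: \<epsilon>_def w_nonneg)
  then have "\<epsilon> t * w (k - t) = 0" using assms(2) by force
  moreover have "k - t < m" using assms(2,3) by linarith
  ultimately show ?thesis using w_pos[of "k - t"] by simp
qed

lemma final_digits_1:
  assumes "debt (Suc k) = 1" and "t \<le> k" and "k < t + m"
  shows "\<epsilon> t = 1"
proof -
  have "(\<Sum>t<Suc k. (1 - \<epsilon> t) * w (Suc k - Suc t)) = (\<Sum>i<Suc k. w i) - debt (Suc k)"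
    unfolding debt_def sum.nat_diff_reindex[symmetric, of w "Suc k"] sum_subtractf[symmetric]
    by (simp add: algebra_simps)
  moreover have nonneg: "(1 - \<epsilon> t) * w (Suc k - Suc t) \<ge> 0" for t
    by (intro mult_nonneg_nonneg) (auto simp: \<epsilon>_def w_nonneg)
  ultimately have "(\<Sum>t<Suc k. (1 - \<epsilon> t) * w (Suc k - Suc t)) = 0"
    using assms(1) sum_w_le_1[of "Suc k"] by (intro antisym sum_nonneg) auto
  then have "\<forall>t\<in>{..<Suc k}. (1 - \<epsilon> t) * w (Suc k - Suc t) = 0"
    using nonneg by (subst (asm) sum_nonneg_eq_0_iff) auto
  then have "(1 - \<epsilon> t) * w (k - t) = 0" using assms(2) by force
  moreover have "k - t < m" using assms(2,3) by linarith
  ultimately show ?thesis using w_pos[of "k - t"] by simp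
qed

lemma plain_sum: "(\<Sum>n\<le>k. d n) = (\<Sum>t\<le>k. \<epsilon> t * (1 - (\<Sum>i<k - t. w i)))"
  using sum_d[of 1] by simp

text \<open>A step that has had \<open>m\<close> successors has been charged exactly what it contributed, and the last \<open>m\<close>
  digits are \<open>0\<close>.\<close>

lemma sum_eq_0:
  assumes "d k < 0"
  shows "(\<Sum>n\<le>k. d n) = 0"
proof -
  have "debt (Suc k) \<noteq> 1"
    using final_digits_1[of k] assms m2 by (auto simp: \<epsilon>_def)
  then have 0: "debt (Suc k) = 0" using final_debt by auto
  have "\<epsilon> t * (1 - (\<Sum>i<k - t. w i)) = 0" if "t \<le> k" for t
  proof (cases "k < t + m")
    case True
    then show ?thesis using final_digits_0[OF 0 that] by simp
  next
    case False
    then show ?thesis by (simp add: sum_w_prefix)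
  qed
  then show ?thesis unfolding plain_sum by (intro sum.neutral) auto
qed

text \<open>Two of the last \<open>m\<close> digits, all equal to \<open>1\<close>, suffice: the very last has not been charged at all, and the
  first still lacks its largest charge \<open>q / \<beta>\<close>.\<close>

lemma sum_lower_bound:
  assumes "d k > 0" and "m \<le> k"
  shows "1 + real q / \<beta> \<le> (\<Sum>n\<le>k. d n)"
proof -
  let ?h = "\<lambda>t. \<epsilon> t * (1 - (\<Sum>i<k - t. w i))"
  have "debt (Suc k) \<noteq> 0"
    using final_digits_0[of k] assms m2 by (auto simp: \<epsilon>_def)
  then have 1: "debt (Suc k) = 1" using final_debt by auto
  have "\<epsilon> (k - (m - 1)) = 1" "\<epsilon> k = 1"
    using assms m2 by (auto intro!: final_digits_1[OF 1])
  moreover have "k - (k - (m - 1)) = m - 1" "k - (m - 1) \<noteq> k"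
    using assms m2 by auto
  ultimately have "(\<Sum>t\<in>{k - (m - 1), k}. ?h t) = 1 + real q / \<beta>"
    by (simp add: sum_w_but_last del: One_nat_def)
  moreover have "(\<Sum>t\<in>{k - (m - 1), k}. ?h t) \<le> (\<Sum>t\<le>k. ?h t)"
    by (intro sum_mono2 mult_nonneg_nonneg) (auto simp: \<epsilon>_def sum_w_le_1)
  ultimately show ?thesis unfolding plain_sum by simp
qed

text \<open>The digit at time \<open>0\<close> bears its full discounted cost because \<open>m \<le> k\<close>, the digit at time \<open>1\<close> is
  \<open>0\<close>, and the rest is dominated by the geometric series from \<open>1 / \<beta>\<^sup>2\<close> on.\<close>

lemma discounted_sum_upper_bound:
  assumes "d 1 < 0" and "m \<le> k"
  shows "(\<Sum>n\<le>k. d n * (1 / \<beta>) ^ n) < 1 - m * q / \<beta> ^ Suc m + 1 / (\<beta> * (\<beta> - 1))"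
proof -
  define h :: "nat \<Rightarrow> real"
    where "h t = (if t = 0 then 1 - m * q / \<beta> ^ Suc m else if t = 1 then 0 else (1 / \<beta>) ^ t)" for t
  have "\<epsilon> t * (1 / \<beta>) ^ t * (1 - (\<Sum>i<k - t. w i * (1 / \<beta>) ^ Suc i)) \<le> h t" for t
  proof -
    consider "t = 0" | "t = 1" | "t \<ge> 2" by linarith
    then show ?thesis
    proof cases
      case 1
      have "\<epsilon> 0 = 1" by (simp add: \<epsilon>_def d_0)
      then show ?thesis using 1 sum_w_discounted[OF assms(2)] by (simp add: h_def)
    next
      case 2
      then show ?thesis using assms(1) by (simp add: h_def \<epsilon>_def)
    next
      case 3
      have "(\<Sum>i<k - t. w i * (1 / \<beta>) ^ Suc i) \<ge> 0"
        using gt_1 by (intro sum_nonneg mult_nonneg_nonneg) (auto simp: w_nonneg)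
      then have "\<epsilon> t * (1 / \<beta>) ^ t * (1 - (\<Sum>i<k - t. w i * (1 / \<beta>) ^ Suc i))
          \<le> (1 * (1 / \<beta>) ^ t) * 1"
        using gt_1 sum_w_discounted_less_1[of "k - t"]
        by (intro mult_mono mult_right_mono) (auto simp: \<epsilon>_def)
      then show ?thesis using 3 by (simp add: h_def)
    qed
  qed
  then have "(\<Sum>n\<le>k. d n * (1 / \<beta>) ^ n) \<le> (\<Sum>t\<le>k. h t)"
    unfolding sum_d by (intro sum_mono) auto
  also have "(\<Sum>t\<le>n. h t) = h 0 + 1 / (\<beta> * (\<beta> - 1)) - 1 / (\<beta> ^ n * (\<beta> - 1))" if "1 \<le> n" for n
    using that
  proof (induction n rule: dec_induct)
    case base
    show ?case by (simp add: h_def)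
  next
    case (step n)
    have "(1 / \<beta>) ^ Suc n = 1 / (\<beta> ^ n * (\<beta> - 1)) - 1 / (\<beta> ^ Suc n * (\<beta> - 1))"
      using gt_1 by (simp add: divide_simps)
    then show ?case using step by (simp add: h_def)
  qed
  then have "(\<Sum>t\<le>k. h t) < h 0 + 1 / (\<beta> * (\<beta> - 1))"
    using assms m2 gt_1 by simp
  finally show ?thesis by (simp add: h_def)
qed

lemma discounted_sum_less_sum:
  assumes "d k > 0" and "d 1 < 0" and "m \<le> k"
  shows "(\<Sum>n\<le>k. d n * (1 / \<beta>) ^ n) < (\<Sum>n\<le>k. d n)"
proof -
  have "1 / (\<beta> * (\<beta> - 1)) < real q / \<beta> + m * q / \<beta> ^ Suc m"
    using divide_strict_right_mono[OF gap_inequality, of \<beta>] gt_1 by (simp add: add_divide_distrib mult.commute)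
  then show ?thesis
    using discounted_sum_upper_bound[OF assms(2,3)] sum_lower_bound[OF assms(1,3)] by linarith
qed

end

section \<open>The mean of the invariant density under matching\<close>

text \<open>The cases \<open>p = 0\<close> and \<open>p = 1\<close> give the normalising integral of \<open>g_tilde\<close> and its first
  moment.\<close>

lemma has_bochner_integral_power_below:
  fixes y :: real
  assumes "0 \<le> y" and "y \<le> 1"
  shows "has_bochner_integral lborel (\<lambda>x. indicator {0..1} x * (x ^ p * of_bool (x < y))) (y ^ Suc p / Suc p)"
proof -
  have "integrable lborel (\<lambda>x::real. x ^ p * indicator {0..y} x)"
    by (intro borel_integrable_atLeastAtMost continuous_intros)
  then have power: "has_bochner_integral lborel (\<lambda>x. x ^ p * indicator {0..y} x) (y ^ Suc p / Suc p)"
    unfolding has_bochner_integral_iff using integral_power[OF assms(1), of p] by simp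
  have eq: "AE x in lborel. x ^ p * indicator {0..y} x = indicator {0..1} x * (x ^ p * of_bool (x < y))"
    using AE_lborel_singleton[of y] by eventually_elim (use assms in \<open>auto simp: indicator_def\<close>)
  have "(\<lambda>x::real. indicator {0..1} x * (x ^ p * of_bool (x < y)))
      = (\<lambda>x. indicator {0..1} x * (x ^ p * indicator {..<y} x))"
    by (auto simp: indicator_def)
  then have "(\<lambda>x::real. indicator {0..1} x * (x ^ p * of_bool (x < y)) :: real) \<in> borel_measurable lborel"
    by simp
  then show ?thesis
    by (intro has_bochner_integral_cong_AE[THEN iffD1, OF _ _ eq power]) simp_all
qed

lemma T_in_unit: "0 \<le> T \<beta> \<alpha> x" "T \<beta> \<alpha> x < 1"
  by (simp_all add: T_def frac_lt_1)

lemma orbit_in_unit: "0 \<le> x \<Longrightarrow> x \<le> 1 \<Longrightarrow> (T \<beta> \<alpha> ^^ n) x \<in> {0..1}"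
  using T_in_unit[of \<beta> \<alpha>] by (cases n) (simp_all add: less_imp_le)

lemma orbits_merge:
  assumes "has_matching_at \<beta> \<alpha> (Suc k)" and "k < n"
  shows "(T \<beta> \<alpha> ^^ n) 1 = (T \<beta> \<alpha> ^^ n) 0"
proof -
  obtain j where "n = j + Suc k"
    using assms(2) by (metis Suc_leI add.commute le_Suc_ex)
  then show ?thesis
    using assms(1) by (simp add: funpow_add has_matching_at_def del: funpow.simps add_Suc_right)
qed

text \<open>The tails of the two series beyond time \<open>k\<close> run over the same indices and cancel.\<close>

lemma g_tilde_matching:
  assumes "\<beta> > 1" and "has_matching_at \<beta> \<alpha> (Suc k)"
  shows "g_tilde \<beta> \<alpha> x
    = (\<Sum>n\<le>k. (of_bool (x < (T \<beta> \<alpha> ^^ n) 1) - of_bool (x < (T \<beta> \<alpha> ^^ n) 0)) * (1 / \<beta>) ^ n)"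
proof -
  have "summable (\<lambda>n. (1 / \<beta>) ^ n)"
    using assms(1) by (intro summable_geometric) auto
  then have "(\<lambda>n. 1 / \<beta> ^ n) summable_on UNIV"
    using assms(1) by (simp add: summable_on_UNIV_nonneg_real_iff power_one_over)
  then have summ: "(\<lambda>n. 1 / \<beta> ^ n) summable_on A" for A
    by (rule summable_on_subset_banach) simp
  have split: "(\<Sum>\<^sub>\<infinity>n\<in>{n. x < u n}. 1 / \<beta> ^ n)
      = (\<Sum>n\<le>k. of_bool (x < u n) * (1 / \<beta>) ^ n) + (\<Sum>\<^sub>\<infinity>n\<in>{n. k < n \<and> x < u n}. 1 / \<beta> ^ n)"
    for u :: "nat \<Rightarrow> real"
  proof -
    have "{n. x < u n} = {n\<in>{..k}. x < u n} \<union> {n. k < n \<and> x < u n}" by auto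
    then have "(\<Sum>\<^sub>\<infinity>n\<in>{n. x < u n}. 1 / \<beta> ^ n)
      = (\<Sum>\<^sub>\<infinity>n\<in>{n\<in>{..k}. x < u n}. 1 / \<beta> ^ n) + (\<Sum>\<^sub>\<infinity>n\<in>{n. k < n \<and> x < u n}. 1 / \<beta> ^ n)"
      by (simp only:) (intro infsum_Un_disjoint summ, auto)
    also have "(\<Sum>\<^sub>\<infinity>n\<in>{n\<in>{..k}. x < u n}. 1 / \<beta> ^ n) = (\<Sum>n\<in>{n\<in>{..k}. x < u n}. 1 / \<beta> ^ n)"
      by (rule infsum_finite) simp
    also have "\<dots> = (\<Sum>n\<le>k. if x < u n then 1 / \<beta> ^ n else 0)"
      by (rule sum.inter_filter) simp
    also have "\<dots> = (\<Sum>n\<le>k. of_bool (x < u n) * (1 / \<beta>) ^ n)"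
      by (intro sum.cong) (auto simp: power_one_over)
    finally show ?thesis .
  qed
  have "{n. k < n \<and> x < (T \<beta> \<alpha> ^^ n) 1} = {n. k < n \<and> x < (T \<beta> \<alpha> ^^ n) 0}"
    using orbits_merge[OF assms(2)] by auto
  then have "g_tilde \<beta> \<alpha> x = (\<Sum>n\<le>k. of_bool (x < (T \<beta> \<alpha> ^^ n) 1) * (1 / \<beta>) ^ n)
      - (\<Sum>n\<le>k. of_bool (x < (T \<beta> \<alpha> ^^ n) 0) * (1 / \<beta>) ^ n)"
    unfolding g_tilde_def split[of "\<lambda>n. (T \<beta> \<alpha> ^^ n) 1"] split[of "\<lambda>n. (T \<beta> \<alpha> ^^ n) 0"]
    by (simp only: add_diff_cancel_right)
  then show ?thesis
    unfolding left_diff_distrib sum_subtractf .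
qed

lemma moment_matching:
  assumes "\<beta> > 1" and "has_matching_at \<beta> \<alpha> (Suc k)"
  shows "(LINT x:{0..1}|lborel. x ^ p * g_tilde \<beta> \<alpha> x)
    = (\<Sum>n\<le>k. (((T \<beta> \<alpha> ^^ n) 1) ^ Suc p - ((T \<beta> \<alpha> ^^ n) 0) ^ Suc p) / Suc p * (1 / \<beta>) ^ n)"
proof -
  let ?f = "\<lambda>u x::real. indicator {0..1} x * (x ^ p * of_bool (x < u)) :: real"
  have "has_bochner_integral lborel
      (\<lambda>x. \<Sum>n\<le>k. (?f ((T \<beta> \<alpha> ^^ n) 1) x - ?f ((T \<beta> \<alpha> ^^ n) 0) x) * (1 / \<beta>) ^ n)
      (\<Sum>n\<le>k. (((T \<beta> \<alpha> ^^ n) 1) ^ Suc p / Suc p - ((T \<beta> \<alpha> ^^ n) 0) ^ Suc p / Suc p) * (1 / \<beta>) ^ n)"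
    using orbit_in_unit[of 0 _ \<beta> \<alpha>] orbit_in_unit[of 1 _ \<beta> \<alpha>]
    by (intro has_bochner_integral_sum has_bochner_integral_mult_left has_bochner_integral_diff
        has_bochner_integral_power_below) auto
  moreover have "(\<Sum>n\<le>k. (?f ((T \<beta> \<alpha> ^^ n) 1) x - ?f ((T \<beta> \<alpha> ^^ n) 0) x) * (1 / \<beta>) ^ n)
      = indicator {0..1} x *\<^sub>R (x ^ p * g_tilde \<beta> \<alpha> x)" for x
    unfolding g_tilde_matching[OF assms] real_scaleR_def sum_distrib_left
    by (intro sum.cong refl) (simp add: algebra_simps)
  ultimately show ?thesis
    unfolding set_lebesgue_integral_def
    by (simp add: has_bochner_integral_iff diff_divide_distrib)
qed

lemma M_matching:
  assumes "\<beta> > 1" and "has_matching_at \<beta> \<alpha> (Suc k)"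
  shows "M \<beta> \<alpha> = (\<Sum>n\<le>k. (((T \<beta> \<alpha> ^^ n) 1)\<^sup>2 - ((T \<beta> \<alpha> ^^ n) 0)\<^sup>2) / 2 * (1 / \<beta>) ^ n)
    / (\<Sum>n\<le>k. \<delta> n \<beta> \<alpha> * (1 / \<beta>) ^ n)"
proof -
  have "M \<beta> \<alpha> = (LINT x:{0..1}|lborel. x ^ 1 * g_tilde \<beta> \<alpha> x)
      / (LINT x:{0..1}|lborel. x ^ 0 * g_tilde \<beta> \<alpha> x)"
    by (simp add: M_def g_def set_lebesgue_integral_def)
  then show ?thesis
    unfolding moment_matching[OF assms] by (simp add: \<delta>_def numeral_2_eq_2)
qed

section \<open>Dependence on the translation parameter\<close>

lemma matching_intervalD:
  assumes "\<alpha> \<in> matching_interval \<beta> as bs" and "length as = Suc k"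
  shows "has_matching_at \<beta> \<alpha> (Suc k)"
    and "n \<le> k \<Longrightarrow> (T \<beta> \<alpha> ^^ Suc n) 0 = \<beta> * (T \<beta> \<alpha> ^^ n) 0 + \<alpha> - as ! n"
    and "n \<le> k \<Longrightarrow> (T \<beta> \<alpha> ^^ Suc n) 1 = \<beta> * (T \<beta> \<alpha> ^^ n) 1 + \<alpha> - bs ! n"
proof -
  show "has_matching_at \<beta> \<alpha> (Suc k)"
    using assms by (simp add: matching_interval_def)
  assume "n \<le> k"
  then have "n < length as" using assms(2) by simp
  then have "(T \<beta> \<alpha> ^^ n) 0 \<in> \<Delta> \<beta> \<alpha> (as ! n)" "(T \<beta> \<alpha> ^^ n) 1 \<in> \<Delta> \<beta> \<alpha> (bs ! n)"
    using assms(1) by (auto simp: matching_interval_def)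
  then show "(T \<beta> \<alpha> ^^ Suc n) 0 = \<beta> * (T \<beta> \<alpha> ^^ n) 0 + \<alpha> - as ! n"
    and "(T \<beta> \<alpha> ^^ Suc n) 1 = \<beta> * (T \<beta> \<alpha> ^^ n) 1 + \<alpha> - bs ! n"
    by (simp_all add: \<Delta>_def T_def frac_def)
qed

text \<open>The digits being the same for both parameters, the difference of the parameters is just propagated
  by the expansion.\<close>

lemma orbit_shift:
  assumes "\<alpha> \<in> matching_interval \<beta> as bs" and "\<alpha>' \<in> matching_interval \<beta> as bs"
    and "length as = Suc k" and "n \<le> k"
  shows "(T \<beta> \<alpha>' ^^ n) 0 = (T \<beta> \<alpha> ^^ n) 0 + (\<alpha>' - \<alpha>) * (\<Sum>i<n. \<beta> ^ i)
       \<and> (T \<beta> \<alpha>' ^^ n) 1 = (T \<beta> \<alpha> ^^ n) 1 + (\<alpha>' - \<alpha>) * (\<Sum>i<n. \<beta> ^ i)"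
  using assms(4)
proof (induction n)
  case 0
  show ?case by simp
next
  case (Suc n)
  then have n: "n \<le> k" by simp
  have "(\<Sum>i<Suc n. \<beta> ^ i) = \<beta> * (\<Sum>i<n. \<beta> ^ i) + 1"
    by (simp add: sum.lessThan_Suc_shift sum_distrib_left del: sum.lessThan_Suc)
  then show ?case
    unfolding matching_intervalD(2,3)[OF assms(1,3) n] matching_intervalD(2,3)[OF assms(2,3) n]
    using Suc.IH[OF n] by (simp del: sum.lessThan_Suc) (simp add: algebra_simps)
qed

lemma \<delta>_const:
  assumes "\<alpha> \<in> matching_interval \<beta> as bs" and "\<alpha>' \<in> matching_interval \<beta> as bs"
    and "length as = Suc k" and "n \<le> k"
  shows "\<delta> n \<beta> \<alpha>' = \<delta> n \<beta> \<alpha>"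
  using orbit_shift[OF assms] by (simp add: \<delta>_def)

text \<open>With a common shift \<open>c\<close> of both end points,
  \<open>((y + c)\<^sup>2 - (x + c)\<^sup>2) / 2 - (y\<^sup>2 - x\<^sup>2) / 2 = c * (y - x)\<close>, and here \<open>y - x\<close> is the constant
  difference \<open>\<delta> n \<beta> \<alpha>\<close>.\<close>

lemma M_difference:
  assumes "\<beta> > 1" and "\<alpha> \<in> matching_interval \<beta> as bs" and "\<alpha>' \<in> matching_interval \<beta> as bs"
    and "length as = Suc k"
  defines "C \<equiv> (\<Sum>n\<le>k. \<delta> n \<beta> \<alpha> * (1 / \<beta>) ^ n)"
  shows "M \<beta> \<alpha>' - M \<beta> \<alpha> = (\<alpha>' - \<alpha>) * ((\<Sum>n\<le>k. \<delta> n \<beta> \<alpha>) - C) / ((\<beta> - 1) * C)"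
proof -
  let ?x = "\<lambda>a n. (T \<beta> a ^^ n) 0" and ?y = "\<lambda>a n. (T \<beta> a ^^ n) 1"
  have "(\<Sum>n\<le>k. \<delta> n \<beta> \<alpha>' * (1 / \<beta>) ^ n) = C"
    unfolding C_def using \<delta>_const[OF assms(2,3,4)] by simp
  then have "M \<beta> \<alpha>' - M \<beta> \<alpha>
      = (\<Sum>n\<le>k. ((?y \<alpha>' n)\<^sup>2 - (?x \<alpha>' n)\<^sup>2) / 2 * (1 / \<beta>) ^ n
              - ((?y \<alpha> n)\<^sup>2 - (?x \<alpha> n)\<^sup>2) / 2 * (1 / \<beta>) ^ n) / C"
    using M_matching[OF assms(1) matching_intervalD(1)[OF assms(2,4)]]
      M_matching[OF assms(1) matching_intervalD(1)[OF assms(3,4)]]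
    by (simp add: C_def sum_subtractf diff_divide_distrib)
  also have "(\<Sum>n\<le>k. ((?y \<alpha>' n)\<^sup>2 - (?x \<alpha>' n)\<^sup>2) / 2 * (1 / \<beta>) ^ n
              - ((?y \<alpha> n)\<^sup>2 - (?x \<alpha> n)\<^sup>2) / 2 * (1 / \<beta>) ^ n)
      = (\<Sum>n\<le>k. (\<alpha>' - \<alpha>) / (\<beta> - 1) * (\<delta> n \<beta> \<alpha> - \<delta> n \<beta> \<alpha> * (1 / \<beta>) ^ n))"
  proof (intro sum.cong refl)
    fix n assume "n \<in> {..k}"
    then have n: "n \<le> k" by simp
    define s where "s = (\<Sum>i<n. \<beta> ^ i)"
    have sh: "?x \<alpha>' n = ?x \<alpha> n + (\<alpha>' - \<alpha>) * s" "?y \<alpha>' n = ?y \<alpha> n + (\<alpha>' - \<alpha>) * s"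
      using orbit_shift[OF assms(2,3,4) n] by (auto simp: s_def)
    have "((?y \<alpha>' n)\<^sup>2 - (?x \<alpha>' n)\<^sup>2) / 2 * (1 / \<beta>) ^ n - ((?y \<alpha> n)\<^sup>2 - (?x \<alpha> n)\<^sup>2) / 2 * (1 / \<beta>) ^ n
        = (\<alpha>' - \<alpha>) * \<delta> n \<beta> \<alpha> * (s * (1 / \<beta>) ^ n)"
    proof -
      have "((y + (\<alpha>' - \<alpha>) * s)\<^sup>2 - (x + (\<alpha>' - \<alpha>) * s)\<^sup>2) / 2 * r - (y\<^sup>2 - x\<^sup>2) / 2 * r
          = (\<alpha>' - \<alpha>) * (y - x) * (s * r)" for x y r
        by (simp add: power2_eq_square field_simps)
      then show ?thesis unfolding sh \<delta>_def .
    qed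
    also have "s = (\<beta> ^ n - 1) / (\<beta> - 1)"
      unfolding s_def using assms(1) by (intro geometric_sum) simp
    also have "(\<beta> ^ n - 1) / (\<beta> - 1) * (1 / \<beta>) ^ n = (1 - (1 / \<beta>) ^ n) / (\<beta> - 1)"
      using assms(1) by (simp add: field_simps)
    finally have step: "((?y \<alpha>' n)\<^sup>2 - (?x \<alpha>' n)\<^sup>2) / 2 * (1 / \<beta>) ^ n - ((?y \<alpha> n)\<^sup>2 - (?x \<alpha> n)\<^sup>2) / 2 * (1 / \<beta>) ^ n
        = (\<alpha>' - \<alpha>) * \<delta> n \<beta> \<alpha> * ((1 - (1 / \<beta>) ^ n) / (\<beta> - 1))" .
    show "((?y \<alpha>' n)\<^sup>2 - (?x \<alpha>' n)\<^sup>2) / 2 * (1 / \<beta>) ^ n - ((?y \<alpha> n)\<^sup>2 - (?x \<alpha> n)\<^sup>2) / 2 * (1 / \<beta>) ^ n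
        = (\<alpha>' - \<alpha>) / (\<beta> - 1) * (\<delta> n \<beta> \<alpha> - \<delta> n \<beta> \<alpha> * (1 / \<beta>) ^ n)"
    proof -
      have "A * D * ((1 - r) / B) = A / B * (D - D * r)" for A B D r :: real
        by (simp add: algebra_simps diff_divide_distrib)
      then show ?thesis by (rule step[THEN trans])
    qed
  qed
  also have "\<dots> = (\<alpha>' - \<alpha>) / (\<beta> - 1) * ((\<Sum>n\<le>k. \<delta> n \<beta> \<alpha>) - C)"
    unfolding C_def sum_distrib_left[symmetric] sum_subtractf ..
  finally show ?thesis by simp
qed

text \<open>For \<open>n > 0\<close> both orbits lie in \<open>[0, 1)\<close>, whence the strict bound; the differences do not vanish
  before time \<open>k + 1\<close> because matching happens there for the first time.\<close>

lemma matching_differences_orbits: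
  assumes "multinacci q m \<beta>" and "has_matching_at \<beta> \<alpha> (Suc k)"
  shows "matching_differences q m \<beta> (\<lambda>n. \<delta> n \<beta> \<alpha>) k"
proof -
  interpret multinacci q m \<beta> by fact
  show ?thesis
  proof
    show "\<delta> 0 \<beta> \<alpha> = 1" by (simp add: \<delta>_def)
    show "\<delta> (Suc k) \<beta> \<alpha> = 0" using orbits_merge[OF assms(2)] by (simp add: \<delta>_def del: funpow.simps)
  next
    fix n :: nat
    assume "0 < n"
    then obtain j where "n = Suc j" by (cases n) auto
    then show "\<bar>\<delta> n \<beta> \<alpha>\<bar> < 1"
      using T_in_unit[of \<beta> \<alpha> "(T \<beta> \<alpha> ^^ j) 1"] T_in_unit[of \<beta> \<alpha> "(T \<beta> \<alpha> ^^ j) 0"]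
      by (simp add: \<delta>_def abs_less_iff)
  next
    fix n assume "n \<le> k"
    moreover have "(T \<beta> \<alpha> ^^ n) 0 \<noteq> (T \<beta> \<alpha> ^^ n) 1" if "0 < n"
      using assms(2) that \<open>n \<le> k\<close> by (simp add: has_matching_at_def del: funpow.simps)
    ultimately show "\<delta> n \<beta> \<alpha> \<noteq> 0"
      by (cases "n = 0") (auto simp: \<delta>_def)
  next
    fix n
    show "\<delta> (Suc n) \<beta> \<alpha> - \<beta> * \<delta> n \<beta> \<alpha> \<in> \<int>"
      by (simp add: \<delta>_def T_def frac_def algebra_simps)
  qed
qed

text \<open>For these parameters \<open>\<lfloor>\<beta> + \<alpha>\<rfloor> = q + 1\<close>, so the first difference is \<open>\<beta> - (q + 1)\<close>.\<close>

lemma \<delta>_1_neg: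
  assumes "multinacci q m \<beta>" and "\<alpha> \<in> {1 - frac \<beta>..<1}"
  shows "\<delta> 1 \<beta> \<alpha> < 0"
proof -
  interpret multinacci q m \<beta> by fact
  have "\<lfloor>\<beta>\<rfloor> = int q" using gt_q lt_q1 by (simp add: floor_eq_iff)
  then have "real q + 1 \<le> \<beta> + \<alpha>" "\<alpha> < 1" "0 \<le> \<alpha>" "\<beta> + \<alpha> < real q + 2"
    using assms(2) lt_q1 gt_q by (auto simp: frac_def)
  then have "\<lfloor>\<beta> + \<alpha>\<rfloor> = int q + 1" "\<lfloor>\<alpha>\<rfloor> = 0" by (simp_all add: floor_eq_iff)
  then show ?thesis using lt_q1 by (simp add: \<delta>_def T_def frac_def)
qed

theorem proposition4p5:
  fixes m q k :: nat and as bs :: "int list" and \<beta> :: real and I :: "real set"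
  assumes "m \<ge> 2" and "q \<ge> 1" and "k \<ge> m"
    and "\<beta> = beta_qm q m"
    and "length as = k + 1" and "set as \<subseteq> {0..\<lfloor>\<beta>\<rfloor> + 1}"
    and "length bs = k + 1" and "set bs \<subseteq> {0..\<lfloor>\<beta>\<rfloor> + 1}"
    and "I = matching_interval \<beta> as bs"
    and "I \<noteq> {}" and "I \<subseteq> {1 - frac \<beta>..<1}"
  shows "((\<forall>\<alpha>\<in>I. \<delta> k \<beta> \<alpha> > 0) \<longrightarrow> strict_mono_on I (M \<beta>)) \<and>
         (\<not> (\<forall>\<alpha>\<in>I. \<delta> k \<beta> \<alpha> > 0) \<longrightarrow> strict_antimono_on I (M \<beta>))"
proof -
  have mult: "multinacci q m \<beta>"
    using beta_qm_root[OF assms(1,2)] assms(1,2,4) by unfold_locales auto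
  then interpret multinacci q m \<beta> .
  have len: "length as = Suc k" using assms(5) by simp
  have diffs: "matching_differences q m \<beta> (\<lambda>n. \<delta> n \<beta> \<alpha>) k" if "\<alpha> \<in> I" for \<alpha>
    using that assms(9) by (intro matching_differences_orbits[OF mult] matching_intervalD(1)[OF _ len]) auto
  show ?thesis
  proof (intro conjI impI)
    assume pos: "\<forall>\<alpha>\<in>I. \<delta> k \<beta> \<alpha> > 0"
    show "strict_mono_on I (M \<beta>)"
    proof (rule monotone_onI)
      fix \<alpha> \<alpha>' assume I: "\<alpha> \<in> I" "\<alpha>' \<in> I" and less: "\<alpha> < \<alpha>'"
      interpret matching_differences q m \<beta> "\<lambda>n. \<delta> n \<beta> \<alpha>" k by (rule diffs[OF I(1)])
      have "\<delta> 1 \<beta> \<alpha> < 0" using \<delta>_1_neg[OF mult] I assms(11) by blast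
      then have "0 < M \<beta> \<alpha>' - M \<beta> \<alpha>"
        using M_difference[OF gt_1 _ _ len, of \<alpha> bs \<alpha>'] I assms(9) less gt_1 discounted_sum_pos
          discounted_sum_less_sum pos assms(3) by simp
      then show "M \<beta> \<alpha> < M \<beta> \<alpha>'" by simp
    qed
  next
    assume "\<not> (\<forall>\<alpha>\<in>I. \<delta> k \<beta> \<alpha> > 0)"
    then obtain \<alpha>0 where "\<alpha>0 \<in> I" "\<not> \<delta> k \<beta> \<alpha>0 > 0" by blast
    then have nonpos: "\<not> \<delta> k \<beta> \<alpha> > 0" if "\<alpha> \<in> I" for \<alpha>
      using \<delta>_const[OF _ _ len order_refl, of \<alpha> \<beta> bs \<alpha>0] that assms(9) by simp
    show "strict_antimono_on I (M \<beta>)"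
    proof (rule monotone_onI)
      fix \<alpha> \<alpha>' assume I: "\<alpha> \<in> I" "\<alpha>' \<in> I" and less: "\<alpha> < \<alpha>'"
      interpret matching_differences q m \<beta> "\<lambda>n. \<delta> n \<beta> \<alpha>" k by (rule diffs[OF I(1)])
      have "\<delta> k \<beta> \<alpha> < 0" using d_nonzero[of k] nonpos[OF I(1)] by auto
      then have "M \<beta> \<alpha>' - M \<beta> \<alpha> = - ((\<alpha>' - \<alpha>) / (\<beta> - 1))"
        using M_difference[OF gt_1 _ _ len, of \<alpha> bs \<alpha>'] I assms(9) gt_1 discounted_sum_pos
        by (simp add: sum_eq_0)
      also have "\<dots> < 0" using less gt_1 by simp
      finally show "M \<beta> \<alpha> > M \<beta> \<alpha>'" by simp
    qed
  qed
qed

end
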